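(* For every integer $p\ge 1$, $$\Gamma_{1,m,p}=\Gamma_{3,m-1,P(a,p)+1}\cup\Gamma_{2,m-1,P(a,p)+1}\cup\Gamma_{1,m-1,P(a,p)+1}\quad\text{for all } m\ge 4,$$ $$\Gamma_{2,m,p}=\Gamma_{3,m-2,P(b,p)+1}\cup\Gamma_{2,m-2,P(b,p)+1}\cup\Gamma_{1,m-2,P(b,p)+1}\quad\text{for all } m\ge 5,$$ $$\Gamma_{3,m,p}=\Gamma_{3,m-3,P(c,p)+1}\cup\Gamma_{2,m-3,P(c,p)+1}\cup\Gamma_{1,m-3,P(c,p)+1}\quad\text{for all } m\ge 6.$$
   Context: The Tribonacci sequence $\mathbb{T}$ is the fixed point beginning with $a$ of the substitution $\sigma(a)=ab,\ \sigma(b)=ac,\ \sigma(c)=a$ on the alphabet $\{a,b,c\}$; positions are numbered from $1$, $\mathbb{T}[1,n]$ is the prefix of length $n$ ($\mathbb{T}[1,0]$ is the empty word), and $|w|_\alpha$ is the number of occurrences of the letter $\alpha$ in the word $w$. For a letter $\alpha\in\{a,b,c\}$ and $p\ge 1$, $P(\alpha,p)$ denotes the position in $\mathbb{T}$ of the $p$-th occurrence of $\alpha$. The Tribonacci numbers are $t_m=|\sigma^m(a)|$ for $m\ge 0$, with $t_{-2}=0$, $t_{-1}=1$ (so $t_0=1,t_1=2,t_2=4,t_3=7$, and $t_m=t_{m-1}+t_{m-2}+t_{m-3}$). The kernel numbers are $k_0=0$, $k_1=k_2=1$, $k_m=k_{m-1}+k_{m-2}+k_{m-3}-1$ for $m\ge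 3$. For $m\ge 3$ and $p\ge 1$ put $$\Lambda(m,p)=p\,t_{m-1}+|\mathbb{T}[1,p-1]|_a\,(t_{m-2}+t_{m-3})+|\mathbb{T}[1,p-1]|_b\,t_{m-2},$$ and define the sets of consecutive integers $$\Gamma_{1,m,p}=\{\Lambda(m,p)+k_{m+2}-1,\dots,\Lambda(m,p)+k_{m+3}-2\},$$ $$\Gamma_{2,m,p}=\{\Lambda(m,p)+k_{m+1}-1,\dots,\Lambda(m,p)+k_{m+2}-2\},$$ $$\Gamma_{3,m,p}=\{\Lambda(m,p)+k_{m}-1,\dots,\Lambda(m,p)+k_{m+1}-2\}.$$ *)

theory Defs
  imports Main "HOL-Library.Stream" "HOL-Library.Infinite_Set"
begin

datatype letter = La | Lb | Lc

fun \<sigma> :: "letter \<Rightarrow> letter list" where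
  "\<sigma> La = [La, Lb]"
| "\<sigma> Lb = [La, Lc]"
| "\<sigma> Lc = [La]"

text \<open>The substitution acts on finite words as a morphism of the free monoid, and on infinite
  words by concatenating the images of the letters.\<close>

definition subst_word :: "letter list \<Rightarrow> letter list" where
  "subst_word w = concat (map \<sigma> w)"

definition subst_stream :: "letter stream \<Rightarrow> letter stream" where
  "subst_stream s = flat (smap \<sigma> s)"

definition tribonacci :: "letter stream" where
  "tribonacci = (THE s. shd s = La \<and> subst_stream s = s)"

definition trib_prefix :: "nat \<Rightarrow> letter list" where
  "trib_prefix n = stake n tribonacci"

text \<open>Streams are indexed from 0, positions in the word from 1; likewise the library's
  \<^const>\<open>enumerate\<close> counts from 0, so the \<open>p\<close>-th occurrence is at index \<open>p - 1\<close>.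
  Meaningful for \<open>p \<ge> 1\<close>.\<close>

definition P :: "letter \<Rightarrow> nat \<Rightarrow> nat" where
  "P \<alpha> p = enumerate {n. 1 \<le> n \<and> tribonacci !! (n - 1) = \<alpha>} (p - 1)"

definition t :: "nat \<Rightarrow> nat" where
  "t m = length ((subst_word ^^ m) [La])"

text \<open>Integer-valued, so that the subtractions here and in the sets below are not truncated.\<close>

fun k :: "nat \<Rightarrow> int" where
  "k 0 = 0"
| "k (Suc 0) = 1"
| "k (Suc (Suc 0)) = 1"
| "k (Suc (Suc (Suc m))) = k (Suc (Suc m)) + k (Suc m) + k m - 1"

text \<open>The index subtractions below are on natural numbers: \<open>\<Lambda>\<close> and the sets \<open>\<Gamma>\<close> are
  meant for \<open>m \<ge> 3\<close> and \<open>p \<ge> 1\<close>.\<close>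

definition \<Lambda> :: "nat \<Rightarrow> nat \<Rightarrow> int" where
  "\<Lambda> m p = int (p * t (m - 1)
      + count_list (trib_prefix (p - 1)) La * (t (m - 2) + t (m - 3))
      + count_list (trib_prefix (p - 1)) Lb * t (m - 2))"

definition \<Gamma>\<^sub>1 :: "nat \<Rightarrow> nat \<Rightarrow> int set" where
  "\<Gamma>\<^sub>1 m p = {\<Lambda> m p + k (m + 2) - 1 .. \<Lambda> m p + k (m + 3) - 2}"

definition \<Gamma>\<^sub>2 :: "nat \<Rightarrow> nat \<Rightarrow> int set" where
  "\<Gamma>\<^sub>2 m p = {\<Lambda> m p + k (m + 1) - 1 .. \<Lambda> m p + k (m + 2) - 2}"

definition \<Gamma>\<^sub>3 :: "nat \<Rightarrow> nat \<Rightarrow> int set" where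
  "\<Gamma>\<^sub>3 m p = {\<Lambda> m p + k m - 1 .. \<Lambda> m p + k (m + 1) - 2}"

text \<open>The definite description is proper: there is exactly one fixed point beginning with
  \<^const>\<open>La\<close>, and every letter occurs in it infinitely often.\<close>

lemma subst_word_append: "subst_word (u @ v) = subst_word u @ subst_word v"
  by (simp add: subst_word_def)

lemma \<sigma>_nonempty [simp]: "\<sigma> x \<noteq> []"
  by (cases x) auto

lemma subst_stream_shift: "subst_stream (u @- s) = subst_word u @- subst_stream s"
  by (induction u) (simp_all add: subst_stream_def subst_word_def)

lemma iterate_Suc: "\<exists>v. v \<noteq> [] \<and> (subst_word ^^ Suc n) [La] = (subst_word ^^ n) [La] @ v"
proof (induction n)
  case 0
  show ?case by (simp add: subst_word_def)
next
  case (Suc n)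
  then obtain v where v: "v \<noteq> []" "(subst_word ^^ Suc n) [La] = (subst_word ^^ n) [La] @ v"
    by blast
  have "(subst_word ^^ Suc (Suc n)) [La] = subst_word ((subst_word ^^ n) [La] @ v)"
    using v(2) by simp
  also have "\<dots> = (subst_word ^^ Suc n) [La] @ subst_word v"
    by (simp add: subst_word_append)
  finally have "(subst_word ^^ Suc (Suc n)) [La] = (subst_word ^^ Suc n) [La] @ subst_word v" .
  moreover have "subst_word v \<noteq> []"
    using v(1) by (cases v) (auto simp: subst_word_def)
  ultimately show ?case by blast
qed

lemma less_t: "n < t n"
proof (induction n)
  case 0
  show ?case by (simp add: t_def)
next
  case (Suc n)
  obtain v where "v \<noteq> []" "(subst_word ^^ Suc n) [La] = (subst_word ^^ n) [La] @ v"
    using iterate_Suc by blast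
  then have "t n < t (Suc n)"
    by (simp add: t_def del: funpow.simps)
  with Suc show ?case by simp
qed

lemma iterate_prefix:
  "m \<le> n \<Longrightarrow> \<exists>v. (subst_word ^^ n) [La] = (subst_word ^^ m) [La] @ v"
proof (induction n rule: dec_induct)
  case base
  show ?case by simp
next
  case (step n)
  then obtain v where v: "(subst_word ^^ n) [La] = (subst_word ^^ m) [La] @ v" by blast
  obtain v' where "(subst_word ^^ Suc n) [La] = (subst_word ^^ n) [La] @ v'"
    using iterate_Suc by blast
  then have "(subst_word ^^ Suc n) [La] = (subst_word ^^ m) [La] @ (v @ v')"
    by (simp only: v append.assoc)
  then show ?case by blast
qed

lemma fixed_point_prefix:
  assumes "shd s = La" "subst_stream s = s"
  shows "\<exists>r. s = (subst_word ^^ n) [La] @- r"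
proof (induction n)
  case 0
  have "s = [La] @- stl s" using assms(1) by (cases s) simp
  then show ?case by (simp only: funpow_0) blast
next
  case (Suc n)
  then obtain r where "s = (subst_word ^^ n) [La] @- r" by blast
  then have "subst_stream s = subst_stream ((subst_word ^^ n) [La] @- r)" by (rule arg_cong)
  then have "s = (subst_word ^^ Suc n) [La] @- subst_stream r"
    by (simp only: assms(2) subst_stream_shift funpow.simps comp_apply)
  then show ?case by blast
qed

lemma stream_eq_by_prefixes:
  assumes "\<And>n. \<exists>r. s = (subst_word ^^ n) [La] @- r"
    and "\<And>n. \<exists>r. s' = (subst_word ^^ n) [La] @- r"
  shows "s = s'"
proof -
  have "s !! i = s' !! i" for i
  proof -
    have i: "i < length ((subst_word ^^ i) [La])"
      using less_t[of i] by (simp add: t_def)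
    obtain r where "s = (subst_word ^^ i) [La] @- r" using assms(1) by blast
    then have "s !! i = (subst_word ^^ i) [La] ! i" using i by (simp only: shift_snth_less)
    moreover obtain r' where "s' = (subst_word ^^ i) [La] @- r'" using assms(2) by blast
    then have "s' !! i = (subst_word ^^ i) [La] ! i" using i by (simp only: shift_snth_less)
    ultimately show ?thesis by simp
  qed
  then have "smap ((!!) s) nats = smap ((!!) s') nats" by presburger
  then show ?thesis by (simp only: flip: stream_smap_nats)
qed

lemma fixed_point_exists: "\<exists>s. shd s = La \<and> subst_stream s = s"
proof -
  define s where "s = smap (\<lambda>i. (subst_word ^^ i) [La] ! i) nats"
  have nth: "s !! i = (subst_word ^^ n) [La] ! i" if "i < t n" for i n
  proof (cases "i \<le> n")
    case True
    then obtain v where "(subst_word ^^ n) [La] = (subst_word ^^ i) [La] @ v"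
      using iterate_prefix by blast
    then show ?thesis using less_t[of i] by (simp add: s_def t_def nth_append)
  next
    case False
    then obtain v where "(subst_word ^^ i) [La] = (subst_word ^^ n) [La] @ v"
      using iterate_prefix[of n i] by auto
    then show ?thesis using that by (simp add: s_def t_def nth_append)
  qed
  have stake: "stake (t n) s = (subst_word ^^ n) [La]" for n
    by (rule nth_equalityI) (auto simp: t_def intro!: nth[unfolded t_def])
  have pre: "s = (subst_word ^^ n) [La] @- sdrop (t n) s" for n
    using stake_sdrop[of "t n" s] by (simp only: stake)
  have pre': "\<exists>r. subst_stream s = (subst_word ^^ n) [La] @- r" for n
  proof -
    obtain v where v: "(subst_word ^^ Suc n) [La] = (subst_word ^^ n) [La] @ v"
      using iterate_Suc by blast
    have "subst_stream s = subst_stream ((subst_word ^^ n) [La] @- sdrop (t n) s)"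
      using pre[of n] by (rule arg_cong)
    also have "\<dots> = (subst_word ^^ Suc n) [La] @- subst_stream (sdrop (t n) s)"
      by (simp add: subst_stream_shift)
    also have "\<dots> = (subst_word ^^ n) [La] @- v @- subst_stream (sdrop (t n) s)"
      by (simp only: v shift_append)
    finally show ?thesis by blast
  qed
  have "subst_stream s = s"
  proof (rule stream_eq_by_prefixes)
    show "\<exists>r. subst_stream s = (subst_word ^^ n) [La] @- r" for n by (rule pre')
    show "\<exists>r. s = (subst_word ^^ n) [La] @- r" for n using pre[of n] by (rule exI)
  qed
  moreover have "shd s = La"
    by (simp add: s_def)
  ultimately show ?thesis by blast
qed

lemma tribonacci_unique: "\<exists>!s. shd s = La \<and> subst_stream s = s"
proof (rule ex_ex1I[OF fixed_point_exists])
  fix s s' assume "shd s = La \<and> subst_stream s = s" "shd s' = La \<and> subst_stream s' = s'"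
  then show "s = s'"
    by (intro stream_eq_by_prefixes) (simp_all add: fixed_point_prefix)
qed

lemma tribonacci_fixed_point: "shd tribonacci = La" "subst_stream tribonacci = tribonacci"
  using theI'[OF tribonacci_unique] by (simp_all add: tribonacci_def)

lemma length_subst_word: "length v \<le> length (subst_word v)"
proof (induction v)
  case (Cons z v)
  have "0 < length (\<sigma> z)" by simp
  with Cons show ?case
    unfolding subst_word_def by (simp only: list.map concat.simps length_append list.size)
qed (simp add: subst_word_def)

lemma subst_occurrence:
  assumes image: "\<sigma> (tribonacci !! i) = x @ \<alpha> # y"
  shows "\<exists>j\<ge>i. tribonacci !! j = \<alpha>"
proof -
  define u where "u = stake i tribonacci"
  define r where "r = sdrop (Suc i) tribonacci"
  have "tribonacci = (u @ [tribonacci !! i]) @- r"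
    unfolding u_def r_def stake_Suc[symmetric] by (rule stake_sdrop[symmetric])
  then have "subst_stream tribonacci = subst_stream ((u @ [tribonacci !! i]) @- r)"
    by (rule arg_cong)
  also have "\<dots> = subst_word (u @ [tribonacci !! i]) @- subst_stream r"
    by (rule subst_stream_shift)
  also have "subst_word (u @ [tribonacci !! i]) = subst_word u @ x @ \<alpha> # y"
    by (simp only: subst_word_append) (simp add: subst_word_def image)
  finally have eq: "tribonacci = (subst_word u @ x) @- \<alpha> ## (y @- subst_stream r)"
    by (simp add: tribonacci_fixed_point(2))
  have "tribonacci !! length (subst_word u @ x) = \<alpha>"
    by (subst eq, subst shift_snth_ge) simp_all
  moreover have "i \<le> length (subst_word u @ x)"
    using length_subst_word[of u] by (simp add: u_def)
  ultimately show ?thesis by blast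
qed

lemma letter_infinitely_often: "infinite {n. 1 \<le> n \<and> tribonacci !! (n - 1) = \<alpha>}"
proof -
  have occ_a: "\<exists>j\<ge>i. tribonacci !! j = La" for i
  proof -
    have "\<exists>y. \<sigma> z = [] @ La # y" for z by (cases z) auto
    then show ?thesis using subst_occurrence by blast
  qed
  have occ_b: "\<exists>j\<ge>i. tribonacci !! j = Lb" for i
  proof -
    obtain j where j: "i \<le> j" "tribonacci !! j = La" using occ_a by blast
    then have "\<sigma> (tribonacci !! j) = [La] @ Lb # []" by simp
    from subst_occurrence[OF this] j(1) show ?thesis by (meson le_trans)
  qed
  have occ_c: "\<exists>j\<ge>i. tribonacci !! j = Lc" for i
  proof -
    obtain j where j: "i \<le> j" "tribonacci !! j = Lb" using occ_b by blast
    then have "\<sigma> (tribonacci !! j) = [La] @ Lc # []" by simp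
    from subst_occurrence[OF this] j(1) show ?thesis by (meson le_trans)
  qed
  have occ: "\<exists>j\<ge>i. tribonacci !! j = \<alpha>" for i
    using occ_a occ_b occ_c by (cases \<alpha>) auto
  have "\<exists>n>i. n \<in> {n. 1 \<le> n \<and> tribonacci !! (n - 1) = \<alpha>}" for i
  proof -
    obtain j where "i \<le> j" "tribonacci !! j = \<alpha>" using occ by blast
    then show ?thesis by (intro exI[of _ "Suc j"]) simp
  qed
  then show ?thesis unfolding infinite_nat_iff_unbounded by blast
qed

end

theory Submission
  imports Defs
begin

text \<open>
  Summing the lengths of the images of the letters gives
  \<open>\<Lambda>(m,p) = t\<^sub>m\<^sub>-\<^sub>1 + |\<sigma>\<^sup>m(u)|\<close>, where \<open>u = T[1,p-1]\<close>. Every letter image contains exactly one \<open>a\<close>, as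
  its first letter, and the letters \<open>b\<close> and \<open>c\<close> arise exactly from \<open>\<sigma>(a)\<close> and \<open>\<sigma>(b)\<close>; hence the
  prefixes of length \<open>P(a,p)\<close>, \<open>P(b,p)\<close>, \<open>P(c,p)\<close> are \<open>\<sigma>(u)a\<close>, \<open>\<sigma>\<^sup>2(u)\<sigma>(a)\<close>, \<open>\<sigma>\<^sup>3(u)\<sigma>\<^sup>2(a)\<close>.
  So \<open>\<Lambda>(m-i,P(\<alpha>,p)+1)\<close> exceeds \<open>\<Lambda>(m,p)\<close> by \<open>t\<^sub>m\<^sub>-\<^sub>i\<^sub>-\<^sub>1\<close> for \<open>i = 1,2,3\<close>, and the endpoints of the
  intervals match because \<open>t\<^sub>n = k\<^sub>n\<^sub>+\<^sub>4 - k\<^sub>n\<^sub>+\<^sub>1\<close>.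
\<close>

lemma subst_word_simps [simp]:
  "subst_word [] = []" "subst_word (x # w) = \<sigma> x @ subst_word w"
  by (simp_all add: subst_word_def)

lemma funpow_subst_word_append:
  "(subst_word ^^ n) (u @ v) = (subst_word ^^ n) u @ (subst_word ^^ n) v"
  by (induction n) (simp_all add: subst_word_append)

lemma funpow_subst_word_Nil [simp]: "(subst_word ^^ n) [] = []"
  by (induction n) simp_all

text \<open>Peeling off the innermost substitution turns \<open>Lc\<close> into \<open>La\<close>,
  \<open>Lb\<close> into \<open>La\<close>, \<open>Lc\<close>, and \<open>La\<close> into
  \<open>La\<close>, \<open>Lb\<close>, so each identity rests on the previous ones.\<close>

lemma
  shows length_funpow_subst_word_Lc: "length ((subst_word ^^ Suc n) [Lc]) = t n"
    and length_funpow_subst_word_Lb: "length ((subst_word ^^ Suc (Suc n)) [Lb]) = t (Suc n) + t n"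
    and t_Suc_Suc_Suc: "t (Suc (Suc (Suc n))) = t (Suc (Suc n)) + t (Suc n) + t n"
proof -
  have split: "(subst_word ^^ i) [x, y] = (subst_word ^^ i) [x] @ (subst_word ^^ i) [y]" for i x y
    using funpow_subst_word_append[of i "[x]" "[y]"] by simp
  show c: "length ((subst_word ^^ Suc n) [Lc]) = t n" for n
    by (simp add: funpow_Suc_right t_def del: funpow.simps)
  show b: "length ((subst_word ^^ Suc (Suc n)) [Lb]) = t (Suc n) + t n" for n
    using c[of n] by (subst funpow_Suc_right) (simp add: split t_def del: funpow.simps)
  show "t (Suc (Suc (Suc n))) = t (Suc (Suc n)) + t (Suc n) + t n"
    unfolding t_def[of "Suc (Suc (Suc n))"] using b[of n]
    by (subst funpow_Suc_right) (simp add: split t_def del: funpow.simps)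
qed

lemma t_initial: "t 0 = 1" "t (Suc 0) = 2" "t (Suc (Suc 0)) = 4"
  by (simp_all add: t_def)

lemma length_funpow_subst_word:
  "length ((subst_word ^^ Suc (Suc n)) w) = count_list w La * t (Suc (Suc n))
     + count_list w Lb * (t (Suc n) + t n) + count_list w Lc * t (Suc n)"
proof (induction w)
  case (Cons x w)
  have "(subst_word ^^ Suc (Suc n)) (x # w)
      = (subst_word ^^ Suc (Suc n)) [x] @ (subst_word ^^ Suc (Suc n)) w"
    using funpow_subst_word_append[of "Suc (Suc n)" "[x]" w] by (simp del: funpow.simps)
  then have "length ((subst_word ^^ Suc (Suc n)) (x # w))
      = length ((subst_word ^^ Suc (Suc n)) [x]) + length ((subst_word ^^ Suc (Suc n)) w)"
    by (simp only: length_append)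
  then show ?case
    unfolding Cons.IH
    using length_funpow_subst_word_Lc[of "Suc n"] length_funpow_subst_word_Lb[of n]
    by (cases x) (simp_all add: t_def algebra_simps del: funpow.simps)
qed simp

lemma length_eq_count_list:
  "length w = count_list w La + count_list w Lb + count_list w Lc"
proof (induction w)
  case (Cons x w)
  then show ?case by (cases x) simp_all
qed simp

lemma \<Lambda>_eq:
  assumes "3 \<le> m"
  shows "\<Lambda> m (Suc n) = int (t (m - 1) + length ((subst_word ^^ m) (trib_prefix n)))"
proof -
  obtain j where m: "m = Suc (Suc (Suc j))"
    using assms by (metis add.commute le_iff_add numeral_3_eq_3 add_Suc_right add_0_right)
  \<comment> \<open>Splitting the factor \<open>Suc n\<close> of \<open>t (m - 1)\<close> by letters
    gives every letter its full weight; for \<open>La\<close> this is \<open>t m\<close>, by the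
    recurrence. The extra 1 leaves the summand \<open>t (m - 1)\<close>.\<close>
  have "n = count_list (trib_prefix n) La + count_list (trib_prefix n) Lb
      + count_list (trib_prefix n) Lc"
    using length_eq_count_list[of "trib_prefix n"] by (simp add: trib_prefix_def)
  then obtain x y z where xyz: "count_list (trib_prefix n) La = x"
      "count_list (trib_prefix n) Lb = y" "count_list (trib_prefix n) Lc = z" "n = x + y + z"
    by blast
  show ?thesis
    unfolding \<Lambda>_def m length_funpow_subst_word
    by (simp only: diff_Suc_1 xyz(1-3))
       (simp add: xyz t_Suc_Suc_Suc algebra_simps numeral_2_eq_2 numeral_3_eq_3)
qed

text \<open>The constant -1 in the recurrence of \<open>k\<close> cancels in the difference, so both
  sides obey the same third-order recurrence; the induction carries three consecutive
  values.\<close>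

lemma t_eq_k_diff: "int (t n) = k (n + 4) - k (n + 1)"
proof -
  have "int (t n) = k (n + 4) - k (n + 1)
      \<and> int (t (Suc n)) = k (Suc n + 4) - k (Suc n + 1)
      \<and> int (t (Suc (Suc n))) = k (Suc (Suc n) + 4) - k (Suc (Suc n) + 1)"
  proof (induction n)
    case 0
    show ?case by (simp add: t_initial eval_nat_numeral)
  next
    case (Suc n)
    then show ?case
      by (simp add: t_Suc_Suc_Suc eval_nat_numeral)
  qed
  then show ?thesis ..
qed

lemma k_le_Suc: "k n \<le> k (Suc n)"
proof -
  \<comment> \<open>The lower bounds 0 and 1 absorb the -1 of the recurrence.\<close>
  have "0 \<le> k n \<and> k n \<le> k (Suc n) \<and> 1 \<le> k (Suc n) \<and> k (Suc n) \<le> k (Suc (Suc n))"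
    by (induction n) auto
  then show ?thesis by simp
qed

text \<open>Each interval starts right after the previous one ends, and monotonicity of
  \<open>k\<close> excludes gaps or overlaps.\<close>

lemma \<Gamma>_union:
  "\<Gamma>\<^sub>3 m q \<union> \<Gamma>\<^sub>2 m q \<union> \<Gamma>\<^sub>1 m q = {\<Lambda> m q + k m - 1 .. \<Lambda> m q + k (m + 3) - 2}"
  using k_le_Suc[of m] k_le_Suc[of "Suc m"] k_le_Suc[of "Suc (Suc m)"]
  unfolding \<Gamma>\<^sub>1_def \<Gamma>\<^sub>2_def \<Gamma>\<^sub>3_def by (auto simp: eval_nat_numeral simp del: k.simps)

lemma enumerate_eqI:
  fixes S :: "nat set"
  assumes "infinite S" "q \<in> S" "card {s \<in> S. s < q} = n"
  shows "enumerate S n = q"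
proof -
  obtain j where j: "enumerate S j = q"
    using enumerate_Ex[OF assms(1,2)] by blast
  have "{s \<in> S. s < q} = enumerate S ` {..<j}"
  proof (intro equalityI subsetI)
    fix s assume s: "s \<in> {s \<in> S. s < q}"
    then obtain i where "enumerate S i = s"
      using enumerate_Ex[OF assms(1)] by blast
    with s j assms(1) show "s \<in> enumerate S ` {..<j}"
      by (auto simp: enumerate_mono_iff)
  qed (use assms(1) j in \<open>auto simp: enumerate_in_set enumerate_mono_iff\<close>)
  then have "card {s \<in> S. s < q} = j"
    using inj_enumerate[OF assms(1)] by (simp add: card_image inj_on_subset[of _ UNIV])
  with assms(3) j show ?thesis by simp
qed

text \<open>Reduces locating the \<open>p\<close>-th occurrence to exhibiting a factorization with
  \<open>p - 1\<close> earlier ones.\<close>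

lemma P_eqI:
  assumes split: "tribonacci = u @- \<alpha> ## r" and count: "count_list u \<alpha> = p - 1"
  shows "P \<alpha> p = length u + 1" "trib_prefix (P \<alpha> p) = u @ [\<alpha>]"
proof -
  let ?S = "{n. 1 \<le> n \<and> tribonacci !! (n - 1) = \<alpha>}"
  have nth: "tribonacci !! i = u ! i" if "i < length u" for i
    unfolding split using that by simp
  \<comment> \<open>\<open>Suc\<close> converts list indices from 0 into positions from 1.\<close>
  have "{s \<in> ?S. s < length u + 1} = Suc ` {i. i < length u \<and> u ! i = \<alpha>}"
  proof (intro equalityI subsetI)
    fix s assume "s \<in> {s \<in> ?S. s < length u + 1}"
    then show "s \<in> Suc ` {i. i < length u \<and> u ! i = \<alpha>}"
      by (cases s) (auto simp: nth)
  qed (auto simp: nth)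
  then have "card {s \<in> ?S. s < length u + 1} = count_list u \<alpha>"
    by (simp only: card_image[OF inj_Suc] count_list_eq_length_filter length_filter_conv_card)
       (simp add: eq_commute)
  moreover have "tribonacci !! length u = \<alpha>"
    by (subst split, subst shift_snth_ge) simp_all
  ultimately show P: "P \<alpha> p = length u + 1"
    unfolding P_def count[symmetric]
    by (intro enumerate_eqI letter_infinitely_often) simp_all
  show "trib_prefix (P \<alpha> p) = u @ [\<alpha>]"
    unfolding P trib_prefix_def by (subst split) (simp add: stake_shift)
qed

lemma tribonacci_shift_subst:
  assumes "tribonacci = u @- r"
  shows "tribonacci = subst_word u @- subst_stream r"
proof -
  have "tribonacci = subst_stream tribonacci"
    by (simp add: tribonacci_fixed_point(2))
  also have "\<dots> = subst_stream (u @- r)"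
    using assms by (rule arg_cong)
  finally show ?thesis
    by (simp only: subst_stream_shift)
qed

lemma count_list_subst_word:
  "count_list (subst_word w) La = length w"
  "count_list (subst_word w) Lb = count_list w La"
  "count_list (subst_word w) Lc = count_list w Lb"
proof (induction w)
  case (Cons x w)
  {
    case 1 then show ?case using Cons by (cases x) simp_all
  next
    case 2 then show ?case using Cons by (cases x) simp_all
  next
    case 3 then show ?case using Cons by (cases x) simp_all
  }
qed simp_all

lemma subst_stream_Cons: "subst_stream (x ## r) = \<sigma> x @- subst_stream r"
  using subst_stream_shift[of "[x]" r] by simp

lemma trib_prefix_P:
  "trib_prefix (P La (Suc n)) = subst_word (trib_prefix n) @ [La]"
  "trib_prefix (P Lb (Suc n)) = (subst_word ^^ 2) (trib_prefix n) @ [La, Lb]"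
  "trib_prefix (P Lc (Suc n)) = (subst_word ^^ 3) (trib_prefix n) @ [La, Lb, La, Lc]"
proof -
  let ?u = "trib_prefix n"
  have len: "length ?u = n" by (simp add: trib_prefix_def)
  obtain x r where r: "tribonacci = ?u @- x ## r"
    unfolding trib_prefix_def
    by (metis stake_sdrop stream.collapse)
  \<comment> \<open>Whatever letter follows \<open>?u\<close>, its image starts with
    \<open>La\<close>, preceded by exactly \<open>n\<close> occurrences. Substituting again turns
    this \<open>La\<close> into \<open>La\<close>, \<open>Lb\<close>, and then the \<open>Lb\<close>
    into \<open>La\<close>, \<open>Lc\<close>, with the count \<open>n\<close> preserved.\<close>
  obtain v where "\<sigma> x = La # v" by (cases x) auto
  then have 1: "tribonacci = subst_word ?u @- La ## (v @- subst_stream r)"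
    using tribonacci_shift_subst[OF r] by (simp add: subst_stream_Cons)
  show "trib_prefix (P La (Suc n)) = subst_word ?u @ [La]"
    by (rule P_eqI(2)[OF 1]) (simp add: count_list_subst_word len)
  obtain r1 where 2: "tribonacci = (subst_word (subst_word ?u) @ [La]) @- Lb ## r1"
    using tribonacci_shift_subst[OF 1] by (simp add: subst_stream_Cons)
  have "trib_prefix (P Lb (Suc n)) = (subst_word (subst_word ?u) @ [La]) @ [Lb]"
    by (rule P_eqI(2)[OF 2]) (simp add: count_list_subst_word len)
  then show "trib_prefix (P Lb (Suc n)) = (subst_word ^^ 2) ?u @ [La, Lb]"
    by (simp add: numeral_2_eq_2)
  obtain r2 where 3:
    "tribonacci = (subst_word (subst_word (subst_word ?u)) @ [La, Lb, La]) @- Lc ## r2"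
    using tribonacci_shift_subst[OF 2] by (simp add: subst_stream_Cons subst_word_append)
  have "trib_prefix (P Lc (Suc n))
      = (subst_word (subst_word (subst_word ?u)) @ [La, Lb, La]) @ [Lc]"
    by (rule P_eqI(2)[OF 3]) (simp add: count_list_subst_word len)
  then show "trib_prefix (P Lc (Suc n)) = (subst_word ^^ 3) ?u @ [La, Lb, La, Lc]"
    by (simp add: numeral_3_eq_3)
qed

lemma \<Lambda>_shift:
  assumes "trib_prefix q = (subst_word ^^ i) (trib_prefix n) @ (subst_word ^^ j) [La]"
    and "i = Suc j" and "3 \<le> m"
  shows "\<Lambda> m (Suc q) = \<Lambda> (m + i) (Suc n) + int (t (m - 1))"
proof -
  \<comment> \<open>Since \<open>m + j = m + i - 1\<close>, the last summand is the leading term of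
    \<open>\<Lambda> (m + i) (Suc n)\<close>.\<close>
  have "length ((subst_word ^^ m) (trib_prefix q))
      = length ((subst_word ^^ (m + i)) (trib_prefix n)) + t (m + j)"
    unfolding assms(1) funpow_subst_word_append t_def by (simp add: funpow_add)
  with assms(2,3) show ?thesis
    by (simp add: \<Lambda>_eq)
qed

theorem mainTheorem1:
  fixes p :: nat
  assumes "1 \<le> p"
  shows "(\<forall>m\<ge>4. \<Gamma>\<^sub>1 m p =
            \<Gamma>\<^sub>3 (m - 1) (P La p + 1) \<union> \<Gamma>\<^sub>2 (m - 1) (P La p + 1) \<union> \<Gamma>\<^sub>1 (m - 1) (P La p + 1))
       \<and> (\<forall>m\<ge>5. \<Gamma>\<^sub>2 m p =
            \<Gamma>\<^sub>3 (m - 2) (P Lb p + 1) \<union> \<Gamma>\<^sub>2 (m - 2) (P Lb p + 1) \<union> \<Gamma>\<^sub>1 (m - 2) (P Lb p + 1))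
       \<and> (\<forall>m\<ge>6. \<Gamma>\<^sub>3 m p =
            \<Gamma>\<^sub>3 (m - 3) (P Lc p + 1) \<union> \<Gamma>\<^sub>2 (m - 3) (P Lc p + 1) \<union> \<Gamma>\<^sub>1 (m - 3) (P Lc p + 1))"
proof -
  obtain n where p: "p = Suc n"
    using assms by (cases p) auto
  have \<Lambda>_P: "\<Lambda> m (P La p + 1) = \<Lambda> (m + 1) p + int (t (m - 1))"
      "\<Lambda> m (P Lb p + 1) = \<Lambda> (m + 2) p + int (t (m - 1))"
      "\<Lambda> m (P Lc p + 1) = \<Lambda> (m + 3) p + int (t (m - 1))" if m: "3 \<le> m" for m
  proof -
    have "trib_prefix (P La p) = (subst_word ^^ 1) (trib_prefix n) @ (subst_word ^^ 0) [La]"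
      by (simp add: p trib_prefix_P(1))
    from \<Lambda>_shift[OF this _ m] show "\<Lambda> m (P La p + 1) = \<Lambda> (m + 1) p + int (t (m - 1))"
      by (simp add: p)
    have "trib_prefix (P Lb p) = (subst_word ^^ 2) (trib_prefix n) @ (subst_word ^^ 1) [La]"
      by (simp add: p trib_prefix_P(2))
    from \<Lambda>_shift[OF this _ m] show "\<Lambda> m (P Lb p + 1) = \<Lambda> (m + 2) p + int (t (m - 1))"
      by (simp add: p)
    have "trib_prefix (P Lc p) = (subst_word ^^ 3) (trib_prefix n) @ (subst_word ^^ 2) [La]"
      by (simp add: p trib_prefix_P(3) numeral_2_eq_2)
    from \<Lambda>_shift[OF this _ m] show "\<Lambda> m (P Lc p + 1) = \<Lambda> (m + 3) p + int (t (m - 1))"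
      by (simp add: p)
  qed
  have t_k: "int (t (m - 1)) = k (m + 3) - k m" if "3 \<le> m" for m
    using that t_eq_k_diff[of "m - 1"] by (simp add: add.commute)
  \<comment> \<open>In all three cases the offsets run from \<open>k (m + 3) - 1\<close> to
    \<open>k (m + 4) - 2\<close>; the upper ends agree because
    \<open>k (m + 4) = 2 * k (m + 3) - k m\<close>.\<close>
  have 1: "\<Gamma>\<^sub>1 (m + 1) p =
      \<Gamma>\<^sub>3 m (P La p + 1) \<union> \<Gamma>\<^sub>2 m (P La p + 1) \<union> \<Gamma>\<^sub>1 m (P La p + 1)" if "3 \<le> m" for m
    unfolding \<Gamma>_union
    unfolding \<Lambda>_P(1)[OF that] t_k[OF that] \<Gamma>\<^sub>1_def by (simp add: eval_nat_numeral)
  have 2: "\<Gamma>\<^sub>2 (m + 2) p =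
      \<Gamma>\<^sub>3 m (P Lb p + 1) \<union> \<Gamma>\<^sub>2 m (P Lb p + 1) \<union> \<Gamma>\<^sub>1 m (P Lb p + 1)" if "3 \<le> m" for m
    unfolding \<Gamma>_union
    unfolding \<Lambda>_P(2)[OF that] t_k[OF that] \<Gamma>\<^sub>2_def by (simp add: eval_nat_numeral)
  have 3: "\<Gamma>\<^sub>3 (m + 3) p =
      \<Gamma>\<^sub>3 m (P Lc p + 1) \<union> \<Gamma>\<^sub>2 m (P Lc p + 1) \<union> \<Gamma>\<^sub>1 m (P Lc p + 1)" if "3 \<le> m" for m
    unfolding \<Gamma>_union
    unfolding \<Lambda>_P(3)[OF that] t_k[OF that] \<Gamma>\<^sub>3_def by (simp add: eval_nat_numeral)
  show ?thesis
  proof (intro conjI allI impI)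
    fix m :: nat
    show "\<Gamma>\<^sub>1 m p = \<Gamma>\<^sub>3 (m - 1) (P La p + 1) \<union> \<Gamma>\<^sub>2 (m - 1) (P La p + 1)
        \<union> \<Gamma>\<^sub>1 (m - 1) (P La p + 1)" if "4 \<le> m"
      using 1[of "m - 1"] that by simp
    show "\<Gamma>\<^sub>2 m p = \<Gamma>\<^sub>3 (m - 2) (P Lb p + 1) \<union> \<Gamma>\<^sub>2 (m - 2) (P Lb p + 1)
        \<union> \<Gamma>\<^sub>1 (m - 2) (P Lb p + 1)" if "5 \<le> m"
      using 2[of "m - 2"] that by (simp del: add_2_eq_Suc')
    show "\<Gamma>\<^sub>3 m p = \<Gamma>\<^sub>3 (m - 3) (P Lc p + 1) \<union> \<Gamma>\<^sub>2 (m - 3) (P Lc p + 1)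
        \<union> \<Gamma>\<^sub>1 (m - 3) (P Lc p + 1)" if "6 \<le> m"
      using 3[of "m - 3"] that by simp
  qed
qed

end
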